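(* Let $k \ge 1$ be an integer and let $S(a,b) = a^2 + b^2$, which is the squared length of the vector $a\cdot 1 + b\cdot\omega_{1/2}$. Then for all integers $a, b$ with $S(a,b) = k$, the vector $(a,b,-a,-b)$ is a unit vector in $M_k$. The other unit vectors of $M_k$ are the $8$ vectors $(a,b,0,0)$ and $(0,0,c,d)$ with $a,b,c,d\in\mathbb{Z}$, $S(a,b) = 1$ and $S(c,d) = 1$ respectively. The number of solutions $(a,b)\in\mathbb{Z}^2$ of $S(a,b) = k$, i.e. the number of unit vectors of $M_k$ minus $8$, is unbounded as $k$ ranges over the integers $k\ge 1$.
   Context: Identify $\mathbb{R}^2$ with $\mathbb{C}$. For an integer $k \ge 1$ let $$\omega_k = \frac{(2k-1) + i\sqrt{4k-1}}{2k} = e^{i\arccos(1 - 1/(2k))},$$ and let $\omega_{1/2} = i$. Define $$M_k = \{a\cdot 1 + b\cdot\omega_{1/2} + c\cdot\omega_k + d\cdot\omega_{1/2}\,\omega_k \mid a,b,c,d\in\mathbb{Z}\} \subset \mathbb{C}.$$ No integer $k\ge 1$ has to be excluded: $4k-1$ is never a perfect square, so $M_k$ is always 4-dimensional (rank 4 as a $\mathbb{Z}$-module). The notation $(a,b,c,d)$ with $a,b,c,d\in\mathbb{Z}$ denotes the element $a\cdot 1 + b\cdot\omega_{1/2} + c\cdot\omega_k + d\cdot\omega_{1/2}\,\omega_k$ of $M_k$. A unit vector of $M_k$ is an element of $M_k$ of absolute value $1$. *)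

theory Defs
  imports Complex_Main
begin

definition omega_half :: complex where
  "omega_half = \<i>"

definition omega :: "int \<Rightarrow> complex" where
  "omega k = (of_int (2 * k - 1) + \<i> * complex_of_real (sqrt (of_int (4 * k - 1)))) / of_int (2 * k)"

lemma omega_eq_cis:
  assumes "k \<ge> 1"
  shows "omega k = cis (arccos (1 - 1 / (2 * of_int k)))"
proof -
  define x :: real where "x = of_int k"
  have x: "x \<ge> 1" using assms by (simp add: x_def)
  define t where "t = 1 - 1 / (2 * x)"
  have t: "0 \<le> t" "t \<le> 1" using x by (auto simp: t_def field_simps)
  have "1 - t\<^sup>2 = (4 * x - 1) / (2 * x)\<^sup>2"
    using x by (simp add: t_def power2_eq_square field_simps)
  then have "sqrt (1 - t\<^sup>2) = sqrt (4 * x - 1) / (2 * x)"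
    using x by (simp only: real_sqrt_divide real_sqrt_abs)
  moreover have "cos (arccos t) = t" using t by (simp add: cos_arccos)
  moreover have "sin (arccos t) = sqrt (1 - t\<^sup>2)" using t by (simp add: sin_arccos)
  moreover have "omega k = Complex ((2 * x - 1) / (2 * x)) (sqrt (4 * x - 1) / (2 * x))"
  proof -
    have "omega k = (complex_of_real (2 * x - 1) + \<i> * complex_of_real (sqrt (4 * x - 1))) / complex_of_real (2 * x)"
      by (simp add: omega_def x_def)
    also have "\<dots> = Complex ((2 * x - 1) / (2 * x)) (sqrt (4 * x - 1) / (2 * x))"
      unfolding complex_eq_iff Re_divide_of_real Im_divide_of_real by simp
    finally show ?thesis .
  qed
  moreover have "(2 * x - 1) / (2 * x) = t" using x by (simp add: t_def field_simps)
  ultimately show ?thesis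
    unfolding t_def[unfolded x_def, symmetric] by (simp add: complex_eq_iff)
qed

text \<open>\<open>mvec k a b c d\<close> is the vector written $(a,b,c,d)$.\<close>

definition mvec :: "int \<Rightarrow> int \<Rightarrow> int \<Rightarrow> int \<Rightarrow> int \<Rightarrow> complex" where
  "mvec k a b c d =
     of_int a * 1 + of_int b * omega_half + of_int c * omega k + of_int d * (omega_half * omega k)"

definition M :: "int \<Rightarrow> complex set" where
  "M k = {mvec k a b c d | a b c d. True}"

definition unit_vectors :: "int \<Rightarrow> complex set" where
  "unit_vectors k = {z \<in> M k. cmod z = 1}"

definition S :: "int \<Rightarrow> int \<Rightarrow> int" where
  "S a b = a\<^sup>2 + b\<^sup>2"

end

theory Submission imports Defs begin

text \<open>
  For \<open>z = \<alpha> + \<beta> \<omega>\<^sub>k\<close> with Gaussian integers \<open>\<alpha>, \<beta>\<close>, write the product of \<open>\<beta>\<close> and the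
  conjugate of \<open>\<alpha>\<close> as \<open>p + q \<i>\<close> and put \<open>n = |\<alpha> + \<beta>|\<^sup>2\<close>. Then
  \<open>k |z|\<^sup>2 = k n - p - q \<surd>(4 k - 1)\<close>. As the square root is irrational, \<open>|z| = 1\<close> forces \<open>q = 0\<close>
  and \<open>p = k (n - 1)\<close>, while \<open>4 p \<le> n\<close> always holds. Hence \<open>n \<le> 1\<close>: \<open>n = 0\<close> means \<open>\<beta> = - \<alpha>\<close> and
  \<open>|\<alpha>|\<^sup>2 = k\<close>, and \<open>n = 1\<close> means \<open>\<alpha> \<beta> = 0\<close>. The number of representations of \<open>k\<close> is unbounded
  because the circle has infinitely many rational points, whose denominators can be cleared.
\<close>

section \<open>Irrationality of the square root of \<open>4 * k - 1\<close>\<close>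

text \<open>Odd squares are 1 modulo 4, whereas \<open>4 * k - 1\<close> is 3 modulo 4.\<close>

lemma four_minus_one_not_square: "4 * k - 1 \<noteq> r\<^sup>2" for k r :: int
proof
  assume eq: "4 * k - 1 = r\<^sup>2"
  have "odd (4 * k - 1)" by simp
  with eq have "odd r" by simp
  then obtain m where "r = 2 * m + 1" by (rule oddE)
  then have "r\<^sup>2 = 4 * (m\<^sup>2 + m) + 1" by (simp add: power2_eq_square algebra_simps)
  with eq show False by presburger
qed

text \<open>After squaring, a relation with nonzero \<open>q\<close> would make
  \<open>4 * k - 1\<close> a square. This is what separates the integer part of an equation from the
  multiple of the root.\<close>

lemma sqrt_four_minus_one_independent:
  fixes k m q :: int
  assumes "k \<ge> 1" and eq: "of_int m = of_int q * sqrt (of_int (4 * k - 1))"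
  shows "q = 0 \<and> m = 0"
proof -
  have "(of_int m :: real)\<^sup>2 = (of_int q)\<^sup>2 * of_int (4 * k - 1)"
    using assms(1) unfolding eq power_mult_distrib by simp
  then have "of_int (m\<^sup>2) = (of_int (q\<^sup>2 * (4 * k - 1)) :: real)" by simp
  then have sq: "m\<^sup>2 = q\<^sup>2 * (4 * k - 1)" by (simp only: of_int_eq_iff)
  have "q = 0"
  proof (rule ccontr)
    assume "q \<noteq> 0"
    from sq have "q\<^sup>2 dvd m\<^sup>2" by simp
    then have "q dvd m" by simp
    then obtain r where "m = q * r" by (rule dvdE)
    with sq \<open>q \<noteq> 0\<close> have "4 * k - 1 = r\<^sup>2" by (simp add: power_mult_distrib)
    then show False using four_minus_one_not_square by blast
  qed
  with sq show ?thesis by simp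
qed

text \<open>With u + v i for \<open>omega k\<close>, the cross term of the squared length is 2 (p u
  - q v). The factor \<open>k\<close> clears the denominators, and 2 k u = 2 k - 1 completes the
  norm of \<alpha> + \<beta> while leaving the extra -p.\<close>

lemma cmod_mvec_sq:
  assumes "k \<ge> 1"
  shows "of_int k * (cmod (mvec k a b c d))\<^sup>2 =
    of_int (k * S (a + c) (b + d) - (a * c + b * d))
      - of_int (a * d - b * c) * sqrt (of_int (4 * k - 1))"
proof -
  define x :: real where "x = of_int k"
  define s where "s = sqrt (4 * x - 1)"
  have x: "x \<ge> 1" using assms by (simp add: x_def)
  then have s: "s\<^sup>2 = 4 * x - 1" by (simp add: s_def)
  define u v where "u = (2 * x - 1) / (2 * x)" and "v = s / (2 * x)"
  have "omega k = (complex_of_real (2 * x - 1) + \<i> * complex_of_real s) / complex_of_real (2 * x)"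
    by (simp add: omega_def x_def s_def)
  also have "\<dots> = Complex u v"
    unfolding complex_eq_iff Re_divide_of_real Im_divide_of_real by (simp add: u_def v_def)
  finally have om: "omega k = Complex u v" .
  have uv: "2 * x * u = 2 * x - 1" "2 * x * v = s" using x by (auto simp: u_def v_def)
  \<comment> \<open>\<open>omega k\<close> has modulus 1 because (2 x - 1)^2 + (4 x - 1) = (2
    x)^2.\<close>
  have "(2 * x)\<^sup>2 * (u\<^sup>2 + v\<^sup>2) = (2 * x * u)\<^sup>2 + (2 * x * v)\<^sup>2"
    by (simp add: power_mult_distrib algebra_simps)
  also have "\<dots> = (2 * x)\<^sup>2"
    unfolding uv s by (simp add: power2_eq_square algebra_simps)
  finally have unit: "u\<^sup>2 + v\<^sup>2 = 1" using x by simp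
  define A B C D :: real
    where "A = of_int a" and "B = of_int b" and "C = of_int c" and "D = of_int d"
  have "(cmod (mvec k a b c d))\<^sup>2 = (A + C * u - D * v)\<^sup>2 + (B + C * v + D * u)\<^sup>2"
    by (simp add: cmod_power2 mvec_def omega_half_def om A_def B_def C_def D_def algebra_simps)
  also have "\<dots> = A\<^sup>2 + B\<^sup>2 + (C\<^sup>2 + D\<^sup>2) * (u\<^sup>2 + v\<^sup>2)
      + 2 * u * (A * C + B * D) - 2 * v * (A * D - B * C)"
    by (simp add: power2_eq_square algebra_simps)
  finally have sq: "(cmod (mvec k a b c d))\<^sup>2 = A\<^sup>2 + B\<^sup>2 + (C\<^sup>2 + D\<^sup>2)
      + 2 * u * (A * C + B * D) - 2 * v * (A * D - B * C)"
    unfolding unit by simp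
  have "x * (cmod (mvec k a b c d))\<^sup>2 = x * (A\<^sup>2 + B\<^sup>2 + C\<^sup>2 + D\<^sup>2)
      + (2 * x * u) * (A * C + B * D) - (2 * x * v) * (A * D - B * C)"
    unfolding sq by (simp add: algebra_simps)
  also have "\<dots> = x * ((A + C)\<^sup>2 + (B + D)\<^sup>2) - (A * C + B * D) - (A * D - B * C) * s"
    unfolding uv by (simp add: power2_eq_square algebra_simps)
  finally show ?thesis
    by (simp add: x_def s_def S_def A_def B_def C_def D_def)
qed

section \<open>\<open>S\<close> as the norm form of the Gaussian integers\<close>

lemma S_nonneg: "S a b \<ge> 0"
  by (simp add: S_def)

lemma S_eq_0_iff: "S a b = 0 \<longleftrightarrow> a = 0 \<and> b = 0"
  by (simp add: S_def sum_power2_eq_zero_iff)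

text \<open>The two sides differ by the norm of \<alpha> - \<beta>.\<close>

lemma four_inner_le: "4 * (a * c + b * d) \<le> S (a + c) (b + d)"
proof -
  have "S (a + c) (b + d) - 4 * (a * c + b * d) = S (a - c) (b - d)"
    by (simp add: S_def power2_eq_square algebra_simps)
  then show ?thesis using S_nonneg[of "a - c" "b - d"] by linarith
qed

text \<open>Multiplicativity of the norm, applied to p + q i: if p = q = 0, then \<alpha> or \<beta>
  vanishes.\<close>

lemma S_mult: "S a b * S c d = S (a * c + b * d) (a * d - b * c)"
  by (simp add: S_def power2_eq_square algebra_simps)

text \<open>Two values of \<open>m\<close> matter: 0 gives the uniqueness of coordinates, 1 the unit
  vectors.\<close>

lemma cmod_mvec_sq_eq_int_iff:
  assumes "k \<ge> 1"
  shows "(cmod (mvec k a b c d))\<^sup>2 = of_int m \<longleftrightarrow>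
    a * d - b * c = 0 \<and> a * c + b * d = k * (S (a + c) (b + d) - m)"
    (is "?L \<longleftrightarrow> ?R")
proof -
  have "?L \<longleftrightarrow> of_int k * (cmod (mvec k a b c d))\<^sup>2 = (of_int (k * m) :: real)"
    using assms by simp
  also have "\<dots> \<longleftrightarrow> of_int (k * S (a + c) (b + d) - (a * c + b * d) - k * m) =
      of_int (a * d - b * c) * sqrt (of_int (4 * k - 1))"
    unfolding cmod_mvec_sq[OF assms] of_int_diff by linarith
  also have "\<dots> \<longleftrightarrow>
      a * d - b * c = 0 \<and> k * S (a + c) (b + d) - (a * c + b * d) - k * m = 0"
    using sqrt_four_minus_one_independent[OF assms] by fastforce
  also have "\<dots> \<longleftrightarrow> ?R" by (simp add: algebra_simps) linarith
  finally show ?thesis .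
qed

text \<open>Here p = k n, so 4 p \<le> n forces n = 0. Then p = q = 0 makes one of \<alpha>, \<beta>
  vanish, and \<alpha> + \<beta> = 0 the other.\<close>

lemma mvec_eq_0_iff:
  assumes "k \<ge> 1"
  shows "mvec k a b c d = 0 \<longleftrightarrow> a = 0 \<and> b = 0 \<and> c = 0 \<and> d = 0"
proof
  assume "mvec k a b c d = 0"
  then have "(cmod (mvec k a b c d))\<^sup>2 = of_int 0" by simp
  then have q: "a * d - b * c = 0" and p: "a * c + b * d = k * S (a + c) (b + d)"
    unfolding cmod_mvec_sq_eq_int_iff[OF assms] by auto
  have "1 * S (a + c) (b + d) \<le> k * S (a + c) (b + d)"
    using assms S_nonneg by (intro mult_right_mono) auto
  with p four_inner_le[of a c b d] S_nonneg[of "a + c" "b + d"]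
  have n: "S (a + c) (b + d) = 0" by simp
  with p q have "S a b * S c d = 0" by (simp add: S_mult S_eq_0_iff)
  with n show "a = 0 \<and> b = 0 \<and> c = 0 \<and> d = 0" by (auto simp: S_eq_0_iff)
next
  assume "a = 0 \<and> b = 0 \<and> c = 0 \<and> d = 0"
  then show "mvec k a b c d = 0" by (simp add: mvec_def)
qed

lemma mvec_eq_iff:
  assumes "k \<ge> 1"
  shows "mvec k a b c d = mvec k a' b' c' d' \<longleftrightarrow> a = a' \<and> b = b' \<and> c = c' \<and> d = d'"
proof -
  have "mvec k a b c d - mvec k a' b' c' d' = mvec k (a - a') (b - b') (c - c') (d - d')"
    by (simp add: mvec_def algebra_simps)
  then have "mvec k a b c d = mvec k a' b' c' d' \<longleftrightarrow>
      mvec k (a - a') (b - b') (c - c') (d - d') = 0"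
    by (metis right_minus_eq)
  then show ?thesis by (simp add: mvec_eq_0_iff[OF assms])
qed

lemma cmod_mvec_eq_1_iff:
  assumes "k \<ge> 1"
  shows "cmod (mvec k a b c d) = 1 \<longleftrightarrow>
    S a b = k \<and> c = - a \<and> d = - b \<or>
    S a b = 1 \<and> c = 0 \<and> d = 0 \<or>
    a = 0 \<and> b = 0 \<and> S c d = 1"
    (is "_ \<longleftrightarrow> ?R")
proof -
  define n where "n = S (a + c) (b + d)"
  have "cmod (mvec k a b c d) = 1 \<longleftrightarrow> (cmod (mvec k a b c d))\<^sup>2 = of_int 1"
    using norm_ge_zero[of "mvec k a b c d"] by (auto simp: power2_eq_1_iff simp del: norm_ge_zero)
  also have "\<dots> \<longleftrightarrow> a * d - b * c = 0 \<and> a * c + b * d = k * (n - 1)"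
    unfolding cmod_mvec_sq_eq_int_iff[OF assms] n_def ..
  also have "\<dots> \<longleftrightarrow> ?R"
  proof
    assume asm: "a * d - b * c = 0 \<and> a * c + b * d = k * (n - 1)"
    have "n \<le> 1"
    proof (rule ccontr)
      assume "\<not> n \<le> 1"
      \<comment> \<open>From n - 1 \<le> p and 4 p \<le> n follows 4 (n - 1) \<le> n, which fails
        for n \<ge> 2.\<close>
      then have "1 * (n - 1) \<le> k * (n - 1)" using assms by (intro mult_right_mono) auto
      also have "\<dots> = a * c + b * d" using asm by simp
      finally show False using four_inner_le[of a c b d] \<open>\<not> n \<le> 1\<close> by (simp add: n_def)
    qed
    moreover have "n \<ge> 0" by (simp add: n_def S_nonneg)
    ultimately consider "n = 0" | "n = 1" by linarith
    then show ?R
    proof cases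
      case 1
      then have "c = - a" "d = - b" unfolding n_def S_eq_0_iff by linarith+
      with asm 1 show ?thesis by (simp add: S_def power2_eq_square)
    next
      case 2
      \<comment> \<open>For n = 1 both p and q are 0, so \<alpha> or \<beta> is 0 and the other has
        norm n.\<close>
      with asm have "S a b * S c d = 0" by (simp add: S_mult S_eq_0_iff)
      with 2 show ?thesis by (auto simp: S_eq_0_iff n_def)
    qed
  next
    assume ?R
    then show "a * d - b * c = 0 \<and> a * c + b * d = k * (n - 1)"
      by (auto simp: n_def S_def power2_eq_square)
  qed
  finally show ?thesis .
qed

section \<open>Lattice points on circles\<close>

text \<open>These are the four Gaussian units; the explicit list reduces the count of 8 to a
  computation.\<close>

lemma S_eq_1_iff: "S a b = 1 \<longleftrightarrow> (a, b) \<in> {(1, 0), (- 1, 0), (0, 1), (0, - 1)}"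
proof
  assume *: "S a b = 1"
  consider "a = 0" | "b = 0" | "\<bar>a\<bar> \<ge> 1" "\<bar>b\<bar> \<ge> 1" by linarith
  then show "(a, b) \<in> {(1, 0), (- 1, 0), (0, 1), (0, - 1)}"
  proof cases
    case 3
    then have "1 \<le> a\<^sup>2" "1 \<le> b\<^sup>2"
      using abs_le_square_iff[of 1 a] abs_le_square_iff[of 1 b] by auto
    with * show ?thesis by (simp add: S_def)
  qed (use * in \<open>auto simp: S_def power2_eq_1_iff\<close>)
qed (auto simp: S_def)

lemma finite_S_eq: "finite {(a, b). S a b = k}"
proof (rule finite_subset)
  have "\<bar>a\<bar> \<le> a\<^sup>2" for a :: int
    using self_le_power[of "\<bar>a\<bar>" 2] by (cases "a = 0") auto
  then have "\<bar>a\<bar> \<le> k \<and> \<bar>b\<bar> \<le> k" if "S a b = k" for a b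
    using that unfolding S_def by (smt (verit) zero_le_power2)
  then show "{(a, b). S a b = k} \<subseteq> {- k..k} \<times> {- k..k}" by fastforce
qed simp

text \<open>The points ((1 - t^2) / (1 + t^2), 2 t / (1 + t^2)) with t = 0, ..., \<open>N\<close>
  lie on the unit circle. Scaling by the common multiple \<open>L\<close> of their denominators
  gives \<open>N\<close> + 1 lattice points, with \<open>L\<^sup>2\<close> as
  \<open>k\<close>.\<close>

lemma card_S_eq_unbounded: "\<exists>k\<ge>1. card {(a, b). S a b = k} > N"
proof -
  define L :: int where "L = (\<Prod>t\<le>N. 1 + (int t)\<^sup>2)"
  have pos: "1 + (int t)\<^sup>2 > 0" for t by (simp add: add_pos_nonneg)
  have L: "L > 0" unfolding L_def using pos by (intro prod_pos) auto
  define c where "c t = L div (1 + (int t)\<^sup>2)" for t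
  have c: "c t * (1 + (int t)\<^sup>2) = L" if "t \<le> N" for t
  proof -
    have "(1 + (int t)\<^sup>2) dvd L" unfolding L_def using that by (intro dvd_prodI) auto
    then show ?thesis by (simp add: c_def)
  qed
  define f where "f t = (c t * (1 - (int t)\<^sup>2), c t * (2 * int t))" for t
  have "inj_on f {..N}"
  proof (rule inj_onI)
    fix t u
    assume tu: "t \<in> {..N}" "u \<in> {..N}" and "f t = f u"
    then have eq: "c t * (1 - (int t)\<^sup>2) = c u * (1 - (int u)\<^sup>2)" by (simp add: f_def)
    \<comment> \<open>Adding this to \<open>eq\<close> gives \<open>c t = c u\<close>; then t^2 =
      u^2, and both are natural numbers.\<close>
    have "c t * (1 + (int t)\<^sup>2) = c u * (1 + (int u)\<^sup>2)" using c tu by simp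
    with eq have cc: "c t = c u" by (simp add: algebra_simps)
    from tu c[of t] L have "c t \<noteq> 0" by auto
    with eq cc show "t = u" by simp
  qed
  then have "card (f ` {..N}) = Suc N" by (simp add: card_image)
  moreover have "f ` {..N} \<subseteq> {(a, b). S a b = L\<^sup>2}"
  proof clarify
    fix t a b
    assume "t \<le> N" and "(a, b) = f t"
    then have "a = c t * (1 - (int t)\<^sup>2)" "b = c t * (2 * int t)" by (simp_all add: f_def)
    then have "S a b = (c t * (1 + (int t)\<^sup>2))\<^sup>2"
      by (simp only: S_def) (simp add: power2_eq_square algebra_simps)
    with c[OF \<open>t \<le> N\<close>] show "S a b = L\<^sup>2" by simp
  qed
  ultimately have "card {(a, b). S a b = L\<^sup>2} > N"
    using card_mono[OF finite_S_eq] by (metis Suc_le_lessD)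
  moreover have "L\<^sup>2 \<ge> 1" using L by (simp add: int_one_le_iff_zero_less)
  ultimately show ?thesis by blast
qed

theorem theorem3p1:
  "(\<forall>k::int. k \<ge> 1 \<longrightarrow>
      (\<forall>a b. of_int (S a b) = (cmod (mvec k a b 0 0))\<^sup>2) \<and>
      (\<forall>a b. S a b = k \<longrightarrow> mvec k a b (- a) (- b) \<in> unit_vectors k) \<and>
      unit_vectors k - {mvec k a b (- a) (- b) | a b. S a b = k} =
        {mvec k a b 0 0 | a b. S a b = 1} \<union> {mvec k 0 0 c d | c d. S c d = 1} \<and>
      card ({mvec k a b 0 0 | a b. S a b = 1} \<union> {mvec k 0 0 c d | c d. S c d = 1}) = 8 \<and>
      finite {(a, b). S a b = k} \<and>
      finite (unit_vectors k) \<and>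
      int (card {(a, b). S a b = k}) = int (card (unit_vectors k)) - 8) \<and>
   (\<forall>N::nat. \<exists>k::int. k \<ge> 1 \<and> card {(a, b). S a b = k} > N)"
proof (intro conjI allI impI)
  fix k :: int
  assume k: "k \<ge> 1"
  let ?E = "{mvec k a b (- a) (- b) | a b. S a b = k}"
  let ?F = "{mvec k a b 0 0 | a b. S a b = 1} \<union> {mvec k 0 0 c d | c d. S c d = 1}"
  show "of_int (S a b) = (cmod (mvec k a b 0 0))\<^sup>2" for a b
    by (simp add: cmod_power2 mvec_def omega_half_def S_def)
  have U: "unit_vectors k = ?E \<union> ?F"
  proof (intro equalityI subsetI)
    fix z
    assume "z \<in> unit_vectors k"
    then obtain a b c d where "z = mvec k a b c d" "cmod (mvec k a b c d) = 1"
      by (auto simp: unit_vectors_def M_def)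
    then show "z \<in> ?E \<union> ?F" unfolding cmod_mvec_eq_1_iff[OF k] by blast
  next
    fix z
    assume "z \<in> ?E \<union> ?F"
    then obtain a b c d where z: "z = mvec k a b c d" and
      "S a b = k \<and> c = - a \<and> d = - b \<or> S a b = 1 \<and> c = 0 \<and> d = 0 \<or> a = 0 \<and> b = 0 \<and> S c d = 1"
      by blast
    then have "cmod z = 1" by (simp only: z cmod_mvec_eq_1_iff[OF k])
    with z show "z \<in> unit_vectors k" unfolding unit_vectors_def M_def by blast
  qed
  show "mvec k a b (- a) (- b) \<in> unit_vectors k" if "S a b = k" for a b
    using that unfolding U by blast
  have disj: "?E \<inter> ?F = {}"
  proof -
    \<comment> \<open>A common vector would have a = b = 0 by uniqueness of coordinates.\<close>
    have "S 0 0 \<noteq> k" using k by (simp add: S_def)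
    then have "mvec k a b (- a) (- b) \<noteq> mvec k a' b' 0 0"
      and "mvec k a b (- a) (- b) \<noteq> mvec k 0 0 c d" if "S a b = k" for a b a' b' c d
      using that by (auto simp only: mvec_eq_iff[OF k] neg_equal_0_iff_equal)
    then show ?thesis by blast
  qed
  then show "unit_vectors k - ?E = ?F" unfolding U by blast
  have "?F = {mvec k 1 0 0 0, mvec k (- 1) 0 0 0, mvec k 0 1 0 0, mvec k 0 (- 1) 0 0,
      mvec k 0 0 1 0, mvec k 0 0 (- 1) 0, mvec k 0 0 0 1, mvec k 0 0 0 (- 1)}"
    unfolding S_eq_1_iff by auto
  then show F: "card ?F = 8" by (simp add: mvec_eq_iff[OF k])
  show fin: "finite {(a, b). S a b = k}" by (rule finite_S_eq)
  have E: "?E = (\<lambda>(a, b). mvec k a b (- a) (- b)) ` {(a, b). S a b = k}" by auto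
  have "inj_on (\<lambda>(a, b). mvec k a b (- a) (- b)) {(a, b). S a b = k}"
    by (auto simp: inj_on_def mvec_eq_iff[OF k])
  then have cardE: "card ?E = card {(a, b). S a b = k}" unfolding E by (rule card_image)
  have finE: "finite ?E" unfolding E using fin by (rule finite_imageI)
  \<comment> \<open>An infinite set has \<open>card\<close> 0, so the count of 8 already yields
    finiteness.\<close>
  have finF: "finite ?F"
  proof (rule card_ge_0_finite)
    show "0 < card ?F" unfolding F by simp
  qed
  show "finite (unit_vectors k)" unfolding U using finE finF by (rule finite_UnI)
  have "card (unit_vectors k) = card ?E + card ?F"
    unfolding U using finE finF disj by (rule card_Un_disjoint)
  then show "int (card {(a, b). S a b = k}) = int (card (unit_vectors k)) - 8"
    unfolding cardE F by simp
next
  show "\<exists>k\<ge>1. card {(a, b). S a b = k} > N" for N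
    by (rule card_S_eq_unbounded)
qed

end
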